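(* Let $N\ge 1$ and let $\theta_1,\dots,\theta_N\in\mathbb{R}$ be sample angles. Put $\omega_j=e^{i\theta_j}$ for $j=1,\dots,N$, and for $n\ge 1$ let $$\hat c_n=\frac1N\sum_{j=1}^N e^{-in\theta_j}.$$ For $z\in\mathbb{C}$ with $|z|<1$ let $$\hat F(z)=1+2\sum_{n=1}^{\infty}\hat c_n z^n .$$ Then for every $z\in\mathbb{C}$ with $|z|<1$, $$\hat F(z)=\frac1N\sum_{j=1}^N\frac{\omega_j+z}{\omega_j-z}.$$ Consequently the (untruncated) orthogonal series estimator of the density coincides with the wrapped Cauchy circular kernel density estimator: for every $r\in[0,1)$ and every $\theta\in\mathbb{R}$, $$\frac{1}{2\pi}\operatorname{Re}\hat F(re^{i\theta})=\frac1N\sum_{j=1}^N f_{WC}(\theta;\theta_j,r).$$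
   Context: The wrapped Cauchy density with location parameter $\mu\in\mathbb{R}$ and concentration parameter $\rho\in[0,1)$ is $$f_{WC}(\theta;\mu,\rho)=\frac{1}{2\pi}\,\frac{1-\rho^2}{1+\rho^2-2\rho\cos(\theta-\mu)} .$$ The wrapped Cauchy circular kernel density estimator based on $\theta_1,\dots,\theta_N$ with smoothing parameter $r$ is $\frac1N\sum_{j=1}^N f_{WC}(\theta;\theta_j,r)$. For a circular density $f$ (nonnegative, $2\pi$-periodic, integrating to $1$ over a period), let $F(z)=\int \frac{e^{i\theta}+z}{e^{i\theta}-z}f(\theta)\,d\theta$ for $|z|<1$ (integral over one period), with expansion $F(z)=1+2\sum_{n\ge1}c_nz^n$, where $c_n=\int e^{-in\theta}f(\theta)\,d\theta$. The function $\hat F$ is obtained by replacing each trigonometric moment $c_n$ by its empirical version $\hat c_n$, and the corresponding orthogonal series estimator of $f(\theta)$ is $\frac1{2\pi}\operatorname{Re}\hat F(re^{i\theta})$. *)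

theory Defs
  imports "HOL-Analysis.Analysis"
begin

definition wrapped_cauchy :: "real \<Rightarrow> real \<Rightarrow> real \<Rightarrow> real" where
  "wrapped_cauchy t \<mu> \<rho> =
     1 / (2 * pi) * ((1 - \<rho>\<^sup>2) / (1 + \<rho>\<^sup>2 - 2 * \<rho> * cos (t - \<mu>)))"

(* The sample consists of \<theta> 1, ..., \<theta> N; values of \<theta> at other indices are irrelevant. *)

definition wrapped_cauchy_kde :: "nat \<Rightarrow> (nat \<Rightarrow> real) \<Rightarrow> real \<Rightarrow> real \<Rightarrow> real" where
  "wrapped_cauchy_kde N \<theta> r t = 1 / real N * (\<Sum>j=1..N. wrapped_cauchy t (\<theta> j) r)"

definition empirical_moment :: "nat \<Rightarrow> (nat \<Rightarrow> real) \<Rightarrow> nat \<Rightarrow> complex" where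
  "empirical_moment N \<theta> n =
     1 / of_nat N * (\<Sum>j=1..N. exp (- \<i> * of_nat n * of_real (\<theta> j)))"

(* The series starts at n = 1, hence the shift by Suc. *)
definition moment_series :: "(nat \<Rightarrow> complex) \<Rightarrow> complex \<Rightarrow> complex" where
  "moment_series c z = 1 + 2 * (\<Sum>n. c (Suc n) * z ^ Suc n)"

definition F_hat :: "nat \<Rightarrow> (nat \<Rightarrow> real) \<Rightarrow> complex \<Rightarrow> complex" where
  "F_hat N \<theta> = moment_series (empirical_moment N \<theta>)"

definition orthogonal_series_estimator :: "nat \<Rightarrow> (nat \<Rightarrow> real) \<Rightarrow> real \<Rightarrow> real \<Rightarrow> real" where
  "orthogonal_series_estimator N \<theta> r t =
     1 / (2 * pi) * Re (F_hat N \<theta> (of_real r * exp (\<i> * of_real t)))"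

end

theory Submission
  imports Defs
begin

text \<open>
  For \<open>\<bar>\<omega>\<bar> = 1\<close> the Herglotz kernel is \<open>(\<omega> + z) / (\<omega> - z) = 1 + 2 q / (1 - q)\<close> with \<open>q = z / \<omega>\<close>, so the
  geometric series expands it into powers of \<open>z\<close> with coefficients \<open>2 \<omega>\<^sup>-\<^sup>n\<close>; averaging over the sample
  gives the moment series. Its real part is the Poisson kernel, which up to the factor
  \<open>1 / (2 \<pi>)\<close> is the wrapped Cauchy density.
\<close>

lemma geometric_Suc_sums:
  fixes q :: "'a::real_normed_field"
  assumes "norm q < 1"
  shows "(\<lambda>n. q ^ Suc n) sums (q / (1 - q))"
  using sums_mult[OF geometric_sums[OF assms], of q] by simp

text \<open>Each sample angle contributes a geometric series, and finitely many convergent series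
  may be averaged termwise. The form with \<open>sums\<close> records convergence and value at once;
  both are needed later.\<close>

lemma empirical_moment_series_sums:
  assumes "norm z < 1"
  shows "(\<lambda>n. empirical_moment N \<theta> (Suc n) * z ^ Suc n) sums
    (1 / of_nat N * (\<Sum>j=1..N. z / (exp (\<i> * of_real (\<theta> j)) - z)))"
proof -
  have "(\<lambda>n. exp (- \<i> * of_nat (Suc n) * of_real (\<theta> j)) * z ^ Suc n) sums
      (z / (exp (\<i> * of_real (\<theta> j)) - z))" for j
  proof -
    define u where "u = exp (\<i> * of_real (\<theta> j))"
    have u: "norm u = 1" "u \<noteq> 0" by (simp_all add: u_def)
    \<comment> \<open>The moment factor is a power of \<open>1 / u\<close>, so each term is a power
      of \<open>z / u\<close>, whose norm is that of \<open>z\<close>.\<close>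
    have "exp (- \<i> * of_nat n * of_real (\<theta> j)) = (1 / u) ^ n" for n
      using exp_of_nat_mult[of n "- (\<i> * of_real (\<theta> j))"]
      by (simp add: u_def exp_minus inverse_eq_divide mult_ac)
    then have "exp (- \<i> * of_nat (Suc n) * of_real (\<theta> j)) * z ^ Suc n = (z / u) ^ Suc n" for n
      by (simp only: power_divide power_one) simp
    moreover have "(\<lambda>n. (z / u) ^ Suc n) sums ((z / u) / (1 - z / u))"
      using assms u by (intro geometric_Suc_sums) (simp add: norm_divide)
    moreover have "(z / u) / (1 - z / u) = z / (u - z)"
      using u assms by (auto simp: field_simps)
    ultimately show ?thesis by (simp only: u_def)
  qed
  then have "(\<lambda>n. 1 / of_nat N *
      (\<Sum>j=1..N. exp (- \<i> * of_nat (Suc n) * of_real (\<theta> j)) * z ^ Suc n)) sums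
      (1 / of_nat N * (\<Sum>j=1..N. z / (exp (\<i> * of_real (\<theta> j)) - z)))"
    by (intro sums_mult sums_sum)
  then show ?thesis
    by (simp only: empirical_moment_def sum_distrib_right mult.assoc)
qed

lemma F_hat_eq_mean_Herglotz_kernel:
  assumes "N \<ge> 1" and "norm z < 1"
  shows "F_hat N \<theta> z = 1 / of_nat N *
    (\<Sum>j=1..N. (exp (\<i> * of_real (\<theta> j)) + z) / (exp (\<i> * of_real (\<theta> j)) - z))"
proof -
  have kernel: "(exp (\<i> * of_real (\<theta> j)) + z) / (exp (\<i> * of_real (\<theta> j)) - z) =
      1 + 2 * (z / (exp (\<i> * of_real (\<theta> j)) - z))" for j
  proof -
    \<comment> \<open>Equality would put \<open>z\<close> on the unit circle.\<close>
    have "exp (\<i> * of_real (\<theta> j)) - z \<noteq> 0"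
      using assms(2) by (metis eq_iff_diff_eq_0 norm_exp_i_times less_irrefl)
    then show ?thesis by (simp add: field_simps)
  qed
  have "F_hat N \<theta> z =
      1 + 2 * (1 / of_nat N * (\<Sum>j=1..N. z / (exp (\<i> * of_real (\<theta> j)) - z)))"
    by (simp only: F_hat_def moment_series_def
        sums_unique[OF empirical_moment_series_sums[OF assms(2)], symmetric])
  \<comment> \<open>The leading 1 moves under the mean as the average of \<open>N\<close> ones,
    which uses \<open>N\<close> nonzero.\<close>
  also have "\<dots> = 1 / of_nat N * (\<Sum>j=1..N. 1 + 2 * (z / (exp (\<i> * of_real (\<theta> j)) - z)))"
    using assms(1) by (simp only: sum.distrib sum_distrib_left[symmetric]) (simp add: field_simps)
  finally show ?thesis by (simp only: kernel)
qed

text \<open>For a quotient a/b the real part is Re (a * cnj b) / |b|^2. With a = u + w and b = u - w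
  the numerator is |u|^2 - |w|^2 (\<open>num\<close>), and the law of cosines gives |u - w|^2
  (\<open>den\<close>).\<close>

lemma Re_Herglotz_kernel:
  "Re ((exp (\<i> * of_real \<mu>) + of_real r * exp (\<i> * of_real t)) /
       (exp (\<i> * of_real \<mu>) - of_real r * exp (\<i> * of_real t))) =
   (1 - r\<^sup>2) / (1 + r\<^sup>2 - 2 * r * cos (t - \<mu>))"
proof -
  have num: "(cos \<mu> + r * cos t) * (cos \<mu> - r * cos t) + (sin \<mu> + r * sin t) * (sin \<mu> - r * sin t) =
      1 - r\<^sup>2"
    using sin_cos_squared_add[of \<mu>] sin_cos_squared_add[of t] by algebra
  have den: "(cos \<mu> - r * cos t)\<^sup>2 + (sin \<mu> - r * sin t)\<^sup>2 = 1 + r\<^sup>2 - 2 * r * cos (t - \<mu>)"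
    unfolding cos_diff
    using sin_cos_squared_add[of \<mu>] sin_cos_squared_add[of t] by algebra
  show ?thesis
    by (simp add: Re_divide Re_exp Im_exp num den)
qed

theorem mainTheorem1:
  fixes N :: nat and \<theta> :: "nat \<Rightarrow> real" and \<omega> :: "nat \<Rightarrow> complex"
  assumes "N \<ge> 1"
    and "\<And>j. j \<in> {1..N} \<Longrightarrow> \<omega> j = exp (\<i> * of_real (\<theta> j))"
  shows "(\<forall>z::complex. norm z < 1 \<longrightarrow>
            summable (\<lambda>n. empirical_moment N \<theta> (Suc n) * z ^ Suc n) \<and>
            F_hat N \<theta> z = 1 / of_nat N * (\<Sum>j=1..N. (\<omega> j + z) / (\<omega> j - z))) \<and>
         (\<forall>r::real. \<forall>t::real. 0 \<le> r \<and> r < 1 \<longrightarrow>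
            orthogonal_series_estimator N \<theta> r t = wrapped_cauchy_kde N \<theta> r t)"
proof (intro conjI allI impI)
  fix z :: complex
  assume z: "norm z < 1"
  \<comment> \<open>\<open>F_hat\<close> is built on \<open>suminf\<close>, which carries no
    information for a divergent series; summability makes the identity below one about a genuine
    limit.\<close>
  show "summable (\<lambda>n. empirical_moment N \<theta> (Suc n) * z ^ Suc n)"
    using empirical_moment_series_sums[OF z] by (rule sums_summable)
  show "F_hat N \<theta> z = 1 / of_nat N * (\<Sum>j=1..N. (\<omega> j + z) / (\<omega> j - z))"
    unfolding F_hat_eq_mean_Herglotz_kernel[OF assms(1) z]
    using assms(2) by simp
next
  fix r t :: real
  assume r: "0 \<le> r \<and> r < 1"
  define z where "z = of_real r * exp (\<i> * of_real t)"
  have z: "norm z < 1"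
    using r by (simp add: z_def norm_mult)
  have "Re (F_hat N \<theta> z) = 1 / real N *
      (\<Sum>j=1..N. (1 - r\<^sup>2) / (1 + r\<^sup>2 - 2 * r * cos (t - \<theta> j)))"
  proof -
    \<comment> \<open>The weight is real, so taking real parts commutes with the mean and the kernel
      lemma applies to each summand.\<close>
    have "Re (1 / of_nat N * w) = 1 / real N * Re w" for w
      by (simp add: Re_divide_of_nat)
    then show ?thesis
      by (simp only: F_hat_eq_mean_Herglotz_kernel[OF assms(1) z] Re_sum)
         (simp only: z_def Re_Herglotz_kernel)
  qed
  then show "orthogonal_series_estimator N \<theta> r t = wrapped_cauchy_kde N \<theta> r t"
    by (simp add: orthogonal_series_estimator_def wrapped_cauchy_kde_def wrapped_cauchy_def
        z_def sum_divide_distrib mult_ac)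
qed

end
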